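(* For every formula $\varphi\in\mathbb{F}_{\varepsilon_0}$ there is $\psi\in\mathrm{MNF}$ such that $\varphi\equiv\psi$ in $\mathbf{TSC}$.
   Context: Ordinals range below $\varepsilon_0$. $\mathbb{F}_{\varepsilon_0}$ is the least set containing $\top$, closed under $\wedge$ and under unary modalities $\langle n^\alpha\rangle$ ($n<\omega$, $\alpha<\varepsilon_0$); $\langle n^0\rangle\varphi$ denotes $\varphi$. Hyper-exponentials: $e^0=\mathrm{id}$, $e^1(\alpha)=-1+\omega^\alpha$, $e^{n+m}=e^n\circ e^m$. MNF is the least set with: $\top\in$ MNF; each monomial $\langle n^\alpha\rangle\top\in$ MNF; if $\langle n_0^{\alpha_0}\rangle\top\wedge\cdots\wedge\langle n_k^{\alpha_k}\rangle\top\in$ MNF, $n<n_0$, and $\alpha=e^{n_0-n}(\alpha_0)\cdot(2+\beta)$ for some $\beta<\varepsilon_0$, then $\langle n^\alpha\rangle\top\wedge\langle n_0^{\alpha_0}\rangle\top\wedge\cdots\wedge\langle n_k^{\alpha_k}\rangle\top\in$ MNF. $\mathbf{TSC}$ derives sequents $\varphi\vdash\psi$; $\varphi\equiv\psi$ means both directions derivable. Axioms: $\varphi\vdash\varphi$; $\varphi\vdash\top$; $\varphi\wedge\psi\vdash\varphi$; $\varphi\wedge\psi\vdash\psi$; $\langle n^\alpha\rangle\varphi\vdash\langle n^\beta\rangle\varphi$ for $\beta\le\alpha$; $\langle n^{\alpha+\beta}\rangle\varphi\equiv\langle n^\beta\rangle\langle n^\alpha\rangle\varphi$; $\langle(m+n)^\alpha\rangle\varphi\vdash\langle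 m^{e^n(\alpha)}\rangle\varphi$; Schmerl axioms $\langle n^\alpha\rangle(\langle n_0^{\alpha_0}\rangle\top\wedge\cdots\wedge\langle n_k^{\alpha_k}\rangle\top)\equiv\langle n^{e^{n_0-n}(\alpha_0)\cdot(1+\alpha)}\rangle\top\wedge\langle n_0^{\alpha_0}\rangle\top\wedge\cdots\wedge\langle n_k^{\alpha_k}\rangle\top$ for $n<n_0$ and the conjunction in MNF. Rules: from $\varphi\vdash\psi$, $\varphi\vdash\chi$ infer $\varphi\vdash\psi\wedge\chi$; from $\varphi\vdash\psi$, $\psi\vdash\chi$ infer $\varphi\vdash\chi$; from $\varphi\vdash\psi$ infer $\langle n^\alpha\rangle\varphi\vdash\langle n^\alpha\rangle\psi$; from $\varphi\vdash\psi$ infer $\langle n^\alpha\rangle\varphi\wedge\langle m^{\beta+1}\rangle\psi\vdash\langle n^\alpha\rangle(\varphi\wedge\langle m^{\beta+1}\rangle\psi)$ for $m<n$. *)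

theory Defs
  imports Main
begin

section \<open>Ordinals below \<open>\<epsilon>\<^sub>0\<close>\<close>

text \<open>
  Ordinals below \<open>\<epsilon>\<^sub>0\<close> are represented by their (hereditary) Cantor normal forms:
  \<open>C a b\<close> stands for \<open>\<omega>\<^sup>a + b\<close>, and in a normal form the exponents are weakly decreasing.
  The facts \<open>eps0_less_add_iff\<close>, \<open>eps0_less_mult_iff\<close>, \<open>eps0_less_omega_iff\<close> below
  are the usual transfinite recursions for sum, product and \<open>\<omega>\<close>-power; together with
  well-foundedness of the order and \<open>eps0_induct\<close> (everything is generated from \<open>0\<close> by sums
  and \<open>\<omega>\<close>-powers) they confirm that this is the ordinal arithmetic of \<open>\<epsilon>\<^sub>0\<close>.
\<close>

datatype cnf = Z | C cnf cnf

fun cnf_less :: "cnf \<Rightarrow> cnf \<Rightarrow> bool" where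
  "cnf_less x Z = False"
| "cnf_less Z (C c d) = True"
| "cnf_less (C a b) (C c d) = (cnf_less a c \<or> a = c \<and> cnf_less b d)"

fun nf :: "cnf \<Rightarrow> bool" where
  "nf Z = True"
| "nf (C a Z) = nf a"
| "nf (C a (C c d)) = (nf a \<and> nf (C c d) \<and> \<not> cnf_less a c)"

fun cnf_add :: "cnf \<Rightarrow> cnf \<Rightarrow> cnf" where
  "cnf_add x Z = x"
| "cnf_add Z (C c d) = C c d"
| "cnf_add (C a b) (C c d) = (if cnf_less a c then C c d else C a (cnf_add b (C c d)))"

text \<open>Right multiplication is additive, \<open>x \<sqdot> 1 = x\<close>, and \<open>(\<omega>\<^sup>a + b) \<sqdot> \<omega>\<^sup>c = \<omega>\<^sup>a\<^sup>+\<^sup>c\<close> for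
  \<open>c > 0\<close> and \<open>\<omega>\<^sup>a + b\<close> in normal form.\<close>

fun cnf_mult :: "cnf \<Rightarrow> cnf \<Rightarrow> cnf" where
  "cnf_mult x Z = Z"
| "cnf_mult Z (C c d) = Z"
| "cnf_mult (C a b) (C c d) =
     (if c = Z then cnf_add (C a b) (cnf_mult (C a b) d)
      else C (cnf_add a c) (cnf_mult (C a b) d))"

lemma cnf_less_irrefl [simp]: "\<not> cnf_less x x"
  by (induction x) auto

lemma cnf_less_trans: "cnf_less x y \<Longrightarrow> cnf_less y z \<Longrightarrow> cnf_less x z"
proof (induction x arbitrary: y z)
  case Z
  then show ?case by (cases y; cases z) auto
next
  case (C a b)
  then show ?case by (cases y; cases z) auto
qed

lemma cnf_less_total: "cnf_less x y \<or> x = y \<or> cnf_less y x"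
proof (induction x arbitrary: y)
  case Z
  then show ?case by (cases y) auto
next
  case (C a b)
  then show ?case by (cases y) auto
qed

lemma cnf_not_less: "\<not> cnf_less x y \<longleftrightarrow> y = x \<or> cnf_less y x"
  using cnf_less_total cnf_less_trans cnf_less_irrefl by metis

lemma cnf_less_Z_iff [simp]: "cnf_less Z y \<longleftrightarrow> y \<noteq> Z"
  by (cases y) auto

lemma cnf_add_Z [simp]: "cnf_add Z y = y"
  by (cases y) auto

lemma cnf_mult_Z [simp]: "cnf_mult Z y = Z"
  by (cases y) auto

fun below :: "cnf \<Rightarrow> cnf \<Rightarrow> bool" where
  "below a Z = True"
| "below a (C c d) = (\<not> cnf_less a c)"

lemma nf_C: "nf (C a b) \<longleftrightarrow> nf a \<and> nf b \<and> below a b"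
  by (cases b) auto

lemma below_trans: "below c b \<Longrightarrow> \<not> cnf_less a c \<Longrightarrow> below a b"
  by (cases b) (auto simp: cnf_not_less dest: cnf_less_trans)

lemma below_add: "below a x \<Longrightarrow> below a y \<Longrightarrow> below a (cnf_add x y)"
  by (cases x; cases y) auto

lemma nf_add: "nf x \<Longrightarrow> nf y \<Longrightarrow> nf (cnf_add x y)"
proof (induction x)
  case (C a b)
  then show ?case by (cases y) (auto simp: nf_C below_add)
qed simp

lemma cnf_add_assoc: "cnf_add (cnf_add x y) z = cnf_add x (cnf_add y z)"
proof (induction x)
  case (C a b)
  show ?case
  proof (cases y)
    case y: (C c d)
    show ?thesis
    proof (cases z)
      case z: (C e f)
      have "cnf_less a e" if "cnf_less a c" "cnf_less c e"
        using that cnf_less_trans by blast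
      moreover have "\<not> cnf_less a e" if "\<not> cnf_less a c" "\<not> cnf_less c e"
        using that cnf_less_trans cnf_not_less by metis
      ultimately show ?thesis using C y z by auto
    qed simp
  qed simp
qed simp

lemma cnf_add_mono: "cnf_less y z \<Longrightarrow> cnf_less (cnf_add x y) (cnf_add x z)"
proof (induction x)
  case (C a b)
  obtain e f where z: "z = C e f" using C.prems by (cases z) auto
  show ?case
  proof (cases y)
    case Z
    then show ?thesis using C z by auto
  next
    case y: (C c d)
    have "cnf_less a e" if "cnf_less a c"
      using that C.prems y z cnf_less_trans by auto
    then show ?thesis using C y z by auto
  qed
qed simp

lemma cnf_add_mono_iff: "cnf_less (cnf_add x y) (cnf_add x z) \<longleftrightarrow> cnf_less y z"
  using cnf_add_mono cnf_less_total cnf_less_trans cnf_less_irrefl by metis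

lemma cnf_add_eq_Z [simp]: "cnf_add x y = Z \<longleftrightarrow> x = Z \<and> y = Z"
  by (cases x; cases y) auto

lemma cnf_sub: "nf x \<Longrightarrow> nf z \<Longrightarrow> \<not> cnf_less z x \<Longrightarrow> \<exists>y. nf y \<and> cnf_add x y = z"
proof (induction x arbitrary: z)
  case (C a b)
  then obtain e f where z: "z = C e f" by (cases z) auto
  show ?case
  proof (cases "cnf_less a e")
    case True
    then show ?thesis using C z by (intro exI[of _ z]) auto
  next
    case False
    then have ea: "e = a" and "\<not> cnf_less f b"
      using C.prems z by (auto simp: cnf_not_less dest: cnf_less_trans)
    then obtain y where y: "nf y" "cnf_add b y = f"
      using C z by (auto simp: nf_C)
    show ?thesis
    proof (cases y)
      case Z
      then show ?thesis using y z ea by (intro exI[of _ y]) auto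
    next
      case yC: (C c d)
      have "\<not> cnf_less a c"
      proof
        assume ac: "cnf_less a c"
        have "cnf_add b y = y"
          using C.prems(1) ac yC by (cases b) (auto simp: cnf_not_less dest: cnf_less_trans)
        then show False using y ac yC z ea C.prems(2) by auto
      qed
      then show ?thesis using y z ea yC by (intro exI[of _ y]) auto
    qed
  qed
qed auto

lemma below_mult:
  "nf y \<Longrightarrow> below c y \<Longrightarrow> below (cnf_add a c) (cnf_mult (C a b) y)"
proof (induction y)
  case (C e f)
  then have "\<not> cnf_less (cnf_add a c) (cnf_add a e)"
    by (simp add: cnf_add_mono_iff)
  moreover have a: "\<not> cnf_less (cnf_add a c) a"
    using cnf_add_mono_iff[of a c Z] by simp
  moreover have "below (cnf_add a c) (cnf_mult (C a b) f)"
    using C below_trans[of e f c] by (auto simp: nf_C)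
  moreover have "below (cnf_add a c) (C a b)"
    using a by simp
  ultimately show ?case
    using below_add by auto
qed simp

lemma nf_mult: "nf x \<Longrightarrow> nf y \<Longrightarrow> nf (cnf_mult x y)"
proof (induction y)
  case (C e f)
  show ?case
  proof (cases x)
    case x: (C a b)
    then show ?thesis
      using C by (auto simp: nf_C below_mult intro!: nf_add)
  qed simp
qed simp

lemma cnf_add_below: "below p v \<Longrightarrow> cnf_add (C p q) v = C p (cnf_add q v)"
  by (cases v) auto

lemma cnf_mult_add:
  "nf y \<Longrightarrow> nf z \<Longrightarrow> cnf_mult x (cnf_add y z) = cnf_add (cnf_mult x y) (cnf_mult x z)"
proof (induction y)
  case (C c d)
  show ?case
  proof (cases x)
    case x: (C a b)
    show ?thesis
    proof (cases z)
      case z: (C e f)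
      show ?thesis
      proof (cases "cnf_less c e")
        case True
        have e: "e \<noteq> Z" using True by (cases e) auto
        have dz: "cnf_add d z = z"
          using C.prems z True by (cases d) (auto simp: cnf_not_less dest: cnf_less_trans)
        have ae: "cnf_less a (cnf_add a e)"
          using cnf_add_mono_iff[of a Z e] e by simp
        have ace: "cnf_less (cnf_add a c) (cnf_add a e)"
          using True by (simp add: cnf_add_mono_iff)
        show ?thesis
        proof (cases "c = Z")
          case True
          have "cnf_add (cnf_mult x (C c d)) (cnf_mult x z) = cnf_add x (cnf_mult x (cnf_add d z))"
            using C True x by (simp add: cnf_add_assoc nf_C)
          also have "\<dots> = cnf_mult x z"
            using dz e ae x z by simp
          finally show ?thesis using \<open>cnf_less c e\<close> z by simp
        next
          case False
          then show ?thesis using x z True ace e by simp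
        qed
      next
        case False
        then have "below (cnf_add a c) (cnf_mult x z)"
          using C.prems z x below_mult[of z c] by (simp del: cnf_mult.simps)
        then show ?thesis
          using C x z False by (cases "c = Z") (auto simp: cnf_add_assoc cnf_add_below nf_C)
      qed
    qed simp
  qed simp
qed simp

lemma cnf_accp: "nf x \<Longrightarrow> Wellfounded.accp (\<lambda>x y. nf x \<and> cnf_less x y) x"
  (is "_ \<Longrightarrow> Wellfounded.accp ?R x")
proof (induction x)
  case Z
  show ?case by (rule accpI) auto
next
  case (C a b)
  have "Wellfounded.accp ?R b \<Longrightarrow> nf (C a b) \<Longrightarrow> Wellfounded.accp ?R (C a b)"
    if "Wellfounded.accp ?R a" for a b
    using that
  proof (induction a arbitrary: b rule: accp.induct)
    case outer: (accI a)
    from outer.prems show ?case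
    proof (induction b rule: accp.induct)
      case inner: (accI b)
      show ?case
      proof (rule accpI)
        fix y assume "nf y \<and> cnf_less y (C a b)"
        then show "Wellfounded.accp ?R y"
        proof (induction y)
          case Z
          show ?case by (rule accpI) auto
        next
          case (C c d)
          show ?case
          proof (cases "cnf_less c a")
            case True
            have "cnf_less d (C a b)"
              using C.prems True by (cases d) (auto simp: cnf_not_less dest: cnf_less_trans)
            then show ?thesis using C True outer.IH by (auto simp: nf_C)
          next
            case False
            then show ?thesis using C inner.IH inner.prems by (auto simp: nf_C)
          qed
        qed
      qed
    qed
  qed
  then show ?case using C by (auto simp: nf_C)
qed

typedef eps0 = "{x. nf x}"
  by (intro exI[of _ Z]) simp

setup_lifting type_definition_eps0

instantiation eps0 :: wellorder
begin

lift_definition less_eps0 :: "eps0 \<Rightarrow> eps0 \<Rightarrow> bool" is cnf_less .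

lift_definition less_eq_eps0 :: "eps0 \<Rightarrow> eps0 \<Rightarrow> bool" is "\<lambda>x y. cnf_less x y \<or> x = y" .

instance
proof
  fix x y z :: eps0
  show "x < y \<longleftrightarrow> x \<le> y \<and> \<not> y \<le> x"
    by transfer (auto dest: cnf_less_trans)
  show "x \<le> x" by transfer simp
  show "x \<le> y \<Longrightarrow> y \<le> z \<Longrightarrow> x \<le> z"
    by transfer (auto dest: cnf_less_trans)
  show "x \<le> y \<Longrightarrow> y \<le> x \<Longrightarrow> x = y"
    by transfer (auto dest: cnf_less_trans)
  show "x \<le> y \<or> y \<le> x"
    by transfer (use cnf_less_total in blast)
next
  fix P :: "eps0 \<Rightarrow> bool" and a
  assume P: "\<And>x. (\<And>y. y < x \<Longrightarrow> P y) \<Longrightarrow> P x"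
  have "P (Abs_eps0 x)" if "Wellfounded.accp (\<lambda>x y. nf x \<and> cnf_less x y) x" "nf x" for x
    using that
  proof (induction x rule: accp.induct)
    case (accI x)
    show ?case
    proof (rule P)
      fix y assume "y < Abs_eps0 x"
      then have y: "nf (Rep_eps0 y)" "cnf_less (Rep_eps0 y) x"
        using Rep_eps0[of y] accI.prems by (auto simp: less_eps0.rep_eq Abs_eps0_inverse)
      have "P (Abs_eps0 (Rep_eps0 y))"
        by (rule accI.IH) (use y in blast)+
      then show "P y" by (simp only: Rep_eps0_inverse)
    qed
  qed
  moreover have "nf (Rep_eps0 a)" using Rep_eps0[of a] by simp
  ultimately have "P (Abs_eps0 (Rep_eps0 a))" using cnf_accp by blast
  then show "P a" by (simp only: Rep_eps0_inverse)
qed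

end

instantiation eps0 :: "{monoid_add, numeral, times}"
begin

lift_definition zero_eps0 :: eps0 is Z by simp

lift_definition one_eps0 :: eps0 is "C Z Z" by simp

lift_definition plus_eps0 :: "eps0 \<Rightarrow> eps0 \<Rightarrow> eps0" is cnf_add by (rule nf_add)

lift_definition times_eps0 :: "eps0 \<Rightarrow> eps0 \<Rightarrow> eps0" is cnf_mult by (rule nf_mult)

instance
  by standard (transfer, simp add: cnf_add_assoc)+

end

lift_definition omega_pow :: "eps0 \<Rightarrow> eps0" (\<open>\<omega>\<^sup>_\<close> [1000] 999) is "\<lambda>a. C a Z" by simp

lemma eps0_zero_le [simp]: "0 \<le> (a::eps0)"
  by transfer auto

lemma eps0_not_less_zero [simp]: "\<not> a < (0::eps0)"
  by (simp add: not_less)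

lemma eps0_add_less_iff [simp]: "a + b < a + c \<longleftrightarrow> b < (c::eps0)"
  by transfer (rule cnf_add_mono_iff)

lemma eps0_add_le_iff [simp]: "a + b \<le> a + c \<longleftrightarrow> b \<le> (c::eps0)"
  by (simp flip: not_less)

lemma eps0_add_cancel [simp]: "a + b = a + c \<longleftrightarrow> b = (c::eps0)"
  by (simp add: order_eq_iff)

lemma eps0_le_add [simp]: "a \<le> a + (b::eps0)"
  using eps0_add_le_iff[of a 0 b] by simp

lemma eps0_le_iff_add: "a \<le> b \<longleftrightarrow> (\<exists>c. b = a + (c::eps0))"
proof
  assume "a \<le> b"
  then show "\<exists>c. b = a + c"
  proof transfer
    fix a b assume "nf a" "nf b" and "cnf_less a b \<or> a = b"
    then have "\<not> cnf_less b a" by (auto dest: cnf_less_trans)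
    then show "\<exists>c\<in>Collect nf. b = cnf_add a c"
      using cnf_sub[OF \<open>nf a\<close> \<open>nf b\<close>] by auto
  qed
qed auto

lemma eps0_less_add_iff: "c < a + b \<longleftrightarrow> c < a \<or> (\<exists>b'<b. c = a + (b'::eps0))"
proof
  assume c: "c < a + b"
  show "c < a \<or> (\<exists>b'<b. c = a + b')"
  proof (cases "c < a")
    case False
    then obtain b' where "c = a + b'" using eps0_le_iff_add[of a c] by auto
    then show ?thesis using c by auto
  qed simp
next
  assume "c < a \<or> (\<exists>b'<b. c = a + b')"
  then show "c < a + b"
    using less_le_trans[OF _ eps0_le_add[of a b], of c] by auto
qed

lemma eps0_le_add_left: "z \<le> d + (z::eps0)"
proof (induction z rule: less_induct)
  case (less z)
  show ?case
  proof (rule ccontr)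
    assume "\<not> z \<le> d + z"
    then have "d + z < z" by simp
    with less[of "d + z"] show False by (simp flip: not_less)
  qed
qed

lemma eps0_add_left_mono: "x \<le> y \<Longrightarrow> x + z \<le> y + (z::eps0)"
  by (auto simp: eps0_le_iff_add[of x y] add.assoc eps0_le_add_left)

lemma eps0_less_one_iff [simp]: "a < (1::eps0) \<longleftrightarrow> a = 0"
  by transfer (metis cnf.exhaust cnf_less.simps cnf_less_Z_iff)

lemma eps0_omega_less_iff [simp]: "\<omega>\<^sup>a < \<omega>\<^sup>b \<longleftrightarrow> a < b"
  by transfer simp

lemma eps0_less_omega_self: "a < \<omega>\<^sup>a"
proof transfer
  fix a show "cnf_less a (C a Z)"
  proof (induction a)
    case (C a b)
    have "cnf_less a (C a b)" using C(1) by (cases b) (auto intro: cnf_less_trans)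
    then show ?case by simp
  qed simp
qed

lemma eps0_omega_zero [simp]: "\<omega>\<^sup>0 = 1"
  by transfer simp

lemma eps0_omega_neq_zero [simp]: "\<omega>\<^sup>a \<noteq> 0"
  by transfer simp

lemma eps0_one_add_omega: "a \<noteq> 0 \<Longrightarrow> 1 + \<omega>\<^sup>a = \<omega>\<^sup>a"
  by transfer auto

lemma eps0_cases:
  obtains "x = (0::eps0)" | a b where "x = \<omega>\<^sup>a + b" "b < x"
proof -
  have "x = 0 \<or> (\<exists>a b. x = \<omega>\<^sup>a + b \<and> b < x)"
  proof transfer
    fix x assume "nf x"
    have less: "cnf_less b (C a b)" if "nf (C a b)" for a b
      using that
    proof (induction b arbitrary: a)
      case (C c d)
      then show ?case by (auto simp: cnf_not_less)
    qed simp
    show "x = Z \<or> (\<exists>a\<in>Collect nf. \<exists>b\<in>Collect nf. x = cnf_add (C a Z) b \<and> cnf_less b x)"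
    proof (cases x)
      case (C a b)
      then have "x = cnf_add (C a Z) b" "nf a" "nf b" "cnf_less b x"
        using \<open>nf x\<close> less by (auto simp: nf_C cnf_add_below)
      then show ?thesis by blast
    qed simp
  qed
  then show thesis using that by blast
qed

lemma eps0_induct [case_names zero add]:
  assumes "P (0::eps0)" and "\<And>a b. P a \<Longrightarrow> P b \<Longrightarrow> P (\<omega>\<^sup>a + b)"
  shows "P x"
proof (induction x rule: less_induct)
  case (less x)
  show ?case
  proof (cases x rule: eps0_cases)
    case (2 a b)
    have "a < x"
      using less_le_trans[OF eps0_less_omega_self eps0_le_add] 2(1) by simp
    then show ?thesis using less 2 assms(2) by auto
  qed (use assms in auto)
qed

lemma eps0_omega_add_closed: "c < \<omega>\<^sup>a \<Longrightarrow> d < \<omega>\<^sup>a \<Longrightarrow> c + d < \<omega>\<^sup>a"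
proof transfer
  fix c d a assume "cnf_less c (C a Z)" "cnf_less d (C a Z)"
  then show "cnf_less (cnf_add c d) (C a Z)" by (cases c; cases d) auto
qed

lemma eps0_mult_zero [simp]: "a * 0 = (0::eps0)" "0 * a = (0::eps0)"
  by (transfer, simp)+

lemma eps0_mult_one [simp]: "a * 1 = (a::eps0)"
proof transfer
  fix a show "cnf_mult a (C Z Z) = a" by (cases a) auto
qed

lemma eps0_mult_add: "a * (b + c) = a * b + a * (c::eps0)"
  by transfer (rule cnf_mult_add)

lemma eps0_mult_omega:
  assumes "a \<noteq> 0"
  obtains l where "\<omega>\<^sup>l \<le> a" "a < \<omega>\<^sup>(l + 1)" "\<And>e. e \<noteq> 0 \<Longrightarrow> a * \<omega>\<^sup>e = \<omega>\<^sup>(l + e)"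
proof -
  have "\<exists>l. \<omega>\<^sup>l \<le> a \<and> a < \<omega>\<^sup>(l + 1) \<and> (\<forall>e. e \<noteq> 0 \<longrightarrow> a * \<omega>\<^sup>e = \<omega>\<^sup>(l + e))"
    using assms
  proof transfer
    fix a assume "nf a" "a \<noteq> Z"
    then obtain l b where a: "a = C l b" "nf l" by (cases a) (auto simp: nf_C)
    have "cnf_less l (cnf_add l (C Z Z))" using cnf_add_mono_iff[of l Z] by simp
    then show "\<exists>l\<in>Collect nf. (cnf_less (C l Z) a \<or> C l Z = a) \<and>
        cnf_less a (C (cnf_add l (C Z Z)) Z) \<and>
        (\<forall>e\<in>Collect nf. e \<noteq> Z \<longrightarrow> cnf_mult a (C e Z) = C (cnf_add l e) Z)"
      using a by (intro bexI[of _ l]) auto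
  qed
  then show thesis using that by blast
qed

lemma eps0_less_mult_iff: "c < a * b \<longleftrightarrow> (\<exists>b'<b. c < a * b' + (a::eps0))"
proof
  assume "\<exists>b'<b. c < a * b' + a"
  then obtain b' where b': "b' < b" "c < a * b' + a" by blast
  then obtain d where d: "b = b' + d" using eps0_le_iff_add[of b' b] by auto
  then have "1 \<le> d" using b' by (auto simp flip: not_less)
  then obtain d' where "d = 1 + d'" using eps0_le_iff_add by auto
  then have "a * b = a * b' + a + a * d'" using d by (simp add: eps0_mult_add add.assoc)
  then show "c < a * b" using b' by (metis eps0_le_add less_le_trans)
next
  assume "c < a * b"
  moreover from this have "a \<noteq> 0" by (auto simp flip: not_le)
  then obtain l where l: "\<omega>\<^sup>l \<le> a" "a < \<omega>\<^sup>(l + 1)" "\<And>e. e \<noteq> 0 \<Longrightarrow> a * \<omega>\<^sup>e = \<omega>\<^sup>(l + e)"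
    using eps0_mult_omega by blast
  ultimately show "\<exists>b'<b. c < a * b' + a"
  proof (induction b arbitrary: c rule: less_induct)
    case (less b)
    show ?case
    proof (cases b rule: eps0_cases)
      case 1
      then show ?thesis using less by simp
    next
      case (2 e r)
      show ?thesis
      proof (cases "r = 0")
        case False
        then have "\<omega>\<^sup>e < b" using 2 eps0_add_less_iff[of "\<omega>\<^sup>e" 0 r] by (simp add: order_less_le)
        from less.prems 2 have "c < a * \<omega>\<^sup>e \<or> (\<exists>c'<a * r. c = a * \<omega>\<^sup>e + c')"
          by (simp add: eps0_mult_add eps0_less_add_iff)
        then show ?thesis
        proof
          assume "c < a * \<omega>\<^sup>e"
          then have "c < a * \<omega>\<^sup>e + a" by (rule less_le_trans) simp
          then show ?thesis using \<open>\<omega>\<^sup>e < b\<close> by blast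
        next
          assume "\<exists>c'<a * r. c = a * \<omega>\<^sup>e + c'"
          then obtain c' where c': "c' < a * r" "c = a * \<omega>\<^sup>e + c'" by blast
          then obtain r' where "r' < r" "c' < a * r' + a" using less 2 by blast
          then have "\<omega>\<^sup>e + r' < b" "c < a * (\<omega>\<^sup>e + r') + a"
            using 2 c' by (simp_all add: eps0_mult_add add.assoc)
          then show ?thesis by blast
        qed
      next
        case True
        then have b: "b = \<omega>\<^sup>e" using 2 by simp
        show ?thesis
        proof (cases "e = 0")
          case True
          then show ?thesis using less b by (intro exI[of _ 0]) simp
        next
          case False
          have "\<exists>b'<\<omega>\<^sup>e. c < a * b'" if "c < \<omega>\<^sup>(l + e)" for c
            using that
          proof (induction c rule: less_induct)
            case (less c)
            show ?case
            proof (cases c rule: eps0_cases)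
              case 1
              have "1 < \<omega>\<^sup>e" using False eps0_omega_less_iff[of 0 e] by (simp add: order_less_le)
              then show ?thesis using 1 \<open>a \<noteq> 0\<close>
                by (intro exI[of _ 1]) (simp add: order_less_le)
            next
              case (2 k s)
              then obtain b'' where b'': "b'' < \<omega>\<^sup>e" "s < a * b''" 
                using less by (meson less_trans)
              have "\<omega>\<^sup>k < \<omega>\<^sup>(l + e)" using 2 less.prems eps0_le_add[of "\<omega>\<^sup>k" s]
                by (metis le_less_trans)
              then have "k < l \<or> (\<exists>e'<e. k = l + e')" by (simp add: eps0_less_add_iff)
              then obtain e' where e': "e' < e" "\<omega>\<^sup>k \<le> a * \<omega>\<^sup>e'"
              proof
                assume "k < l"
                then have "\<omega>\<^sup>k \<le> a * \<omega>\<^sup>0"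
                  using l(1) eps0_omega_less_iff[of k l] by (auto simp del: eps0_omega_less_iff)
                moreover have "0 < e" using False by (simp add: order_less_le)
                ultimately show thesis using that by blast
              next
                assume "\<exists>e'<e. k = l + e'"
                then obtain e' where "e' < e" "k = l + e'" by blast
                then show thesis using that[of e'] l by (cases "e' = 0") auto
              qed
              have "\<omega>\<^sup>e' + b'' < \<omega>\<^sup>e"
                using b'' e' by (intro eps0_omega_add_closed) auto
              moreover have "c < \<omega>\<^sup>k + a * b''" using 2 b'' by simp
              then have "c < a * (\<omega>\<^sup>e' + b'')"
                using eps0_add_left_mono[OF e'(2), of "a * b''"] by (simp add: eps0_mult_add)
              ultimately show ?thesis by blast
            qed
          qed
          then obtain b' where "b' < \<omega>\<^sup>e" "c < a * b'"
            using less.prems b l False by auto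
          moreover have "a * b' \<le> a * b' + a" by simp
          ultimately show ?thesis using b by (meson less_le_trans)
        qed
      qed
    qed
  qed
qed

lemma eps0_less_omega_iff:
  "c < \<omega>\<^sup>b \<longleftrightarrow> c = 0 \<or> (\<exists>b'<b. \<exists>n. c < (((+) (\<omega>\<^sup>b')) ^^ n) 0)"
proof
  assume c: "c < \<omega>\<^sup>b"
  have *: "\<exists>n. c < (((+) (\<omega>\<^sup>k)) ^^ n) 0" if "c < \<omega>\<^sup>(k + 1)" for c k
    using that
  proof (induction c rule: less_induct)
    case (less c)
    show ?case
    proof (cases c rule: eps0_cases)
      case 1
      then show ?thesis by (intro exI[of _ 1]) (simp add: order_less_le)
    next
      case (2 j s)
      then obtain n where "s < (((+) (\<omega>\<^sup>k)) ^^ n) 0"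
        using less by (meson less_trans)
      then have "c < \<omega>\<^sup>j + (((+) (\<omega>\<^sup>k)) ^^ n) 0" using 2 by simp
      moreover have "\<omega>\<^sup>j < \<omega>\<^sup>(k + 1)"
        using 2 less.prems eps0_le_add[of "\<omega>\<^sup>j" s] by (metis le_less_trans)
      then have "j \<le> k" by (auto simp: eps0_less_add_iff)
      then have "\<omega>\<^sup>j \<le> \<omega>\<^sup>k" by (auto simp: order_le_less)
      ultimately have "c < (((+) (\<omega>\<^sup>k)) ^^ Suc n) 0"
        using eps0_add_left_mono[of "\<omega>\<^sup>j" "\<omega>\<^sup>k"] by (simp add: less_le_trans)
      then show ?thesis by blast
    qed
  qed
  show "c = 0 \<or> (\<exists>b'<b. \<exists>n. c < (((+) (\<omega>\<^sup>b')) ^^ n) 0)"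
  proof (cases "c = 0")
    case False
    then obtain l where l: "\<omega>\<^sup>l \<le> c" "c < \<omega>\<^sup>(l + 1)" using eps0_mult_omega by blast
    then have "\<omega>\<^sup>l < \<omega>\<^sup>b" using c by (metis le_less_trans)
    then have "l < b" by simp
    then show ?thesis using *[OF l(2)] by blast
  qed simp
next
  have pos: "0 < \<omega>\<^sup>b" by (simp add: order_less_le)
  assume "c = 0 \<or> (\<exists>b'<b. \<exists>n. c < (((+) (\<omega>\<^sup>b')) ^^ n) 0)"
  then show "c < \<omega>\<^sup>b"
  proof
    assume "\<exists>b'<b. \<exists>n. c < (((+) (\<omega>\<^sup>b')) ^^ n) 0"
    then obtain b' n where b': "b' < b" "c < (((+) (\<omega>\<^sup>b')) ^^ n) 0" by blast
    have "(((+) (\<omega>\<^sup>b')) ^^ n) 0 < \<omega>\<^sup>b"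
      using b'(1) pos by (induction n) (auto intro: eps0_omega_add_closed)
    then show ?thesis using b' by simp
  qed (use pos in simp)
qed

text \<open>The unary \<open>e\<close>: \<open>-1 + \<omega>\<^sup>\<alpha>\<close> is a left subtraction, the unique \<open>\<gamma>\<close> with \<open>1 + \<gamma> = \<omega>\<^sup>\<alpha>\<close>.\<close>

definition hexp1 :: "eps0 \<Rightarrow> eps0" where
  "hexp1 \<alpha> = (THE \<gamma>. 1 + \<gamma> = \<omega>\<^sup>\<alpha>)"

definition hexp :: "nat \<Rightarrow> eps0 \<Rightarrow> eps0" where
  "hexp n = hexp1 ^^ n"

lemma hexp1_eq: "hexp1 \<alpha> = (if \<alpha> = 0 then 0 else \<omega>\<^sup>\<alpha>)"
proof (cases "\<alpha> = 0")
  case True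
  have "(1 + \<gamma> = 1) = (\<gamma> = 0)" for \<gamma> :: eps0
    using eps0_add_cancel[of 1 \<gamma> 0] by simp
  then show ?thesis using True by (simp add: hexp1_def)
next
  case False
  have "1 + \<gamma> = \<omega>\<^sup>\<alpha> \<longleftrightarrow> \<gamma> = \<omega>\<^sup>\<alpha>" for \<gamma>
    using eps0_add_cancel[of 1 \<gamma> "\<omega>\<^sup>\<alpha>"] eps0_one_add_omega[OF False] by simp
  then show ?thesis using False by (simp add: hexp1_def)
qed

lemma hexp_rec: "hexp 0 = id" "hexp 1 = hexp1" "hexp (n + m) = hexp n \<circ> hexp m"
  by (simp_all add: hexp_def funpow_add)

section \<open>Formulas\<close>

text \<open>
  The convention that \<open>\<langle>n\<^sup>0\<rangle>\<phi>\<close> is \<open>\<phi>\<close> itself is built into \<open>dia\<close>. The constructor \<open>Mod\<close> is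
  never used directly, so that \<open>Mod n 0 \<phi>\<close> does not occur in \<open>formulas\<close>.
\<close>

datatype fm = Top | Conj fm fm (infixr \<open>\<^bold>\<and>\<close> 55) | Mod nat eps0 fm

definition dia :: "nat \<Rightarrow> eps0 \<Rightarrow> fm \<Rightarrow> fm" where
  "dia n \<alpha> \<phi> = (if \<alpha> = 0 then \<phi> else Mod n \<alpha> \<phi>)"

inductive_set formulas :: "fm set" where
  "Top \<in> formulas"
| "\<lbrakk>\<phi> \<in> formulas; \<psi> \<in> formulas\<rbrakk> \<Longrightarrow> \<phi> \<^bold>\<and> \<psi> \<in> formulas"
| "\<phi> \<in> formulas \<Longrightarrow> dia n \<alpha> \<phi> \<in> formulas"

text \<open>\<open>mono_conj [(n\<^sub>0, \<alpha>\<^sub>0), \<dots>, (n\<^sub>k, \<alpha>\<^sub>k)]\<close> is \<open>\<langle>n\<^sub>0\<^bsup>\<alpha>\<^sub>0\<^esup>\<rangle>\<top> \<and> \<dots> \<and> \<langle>n\<^sub>k\<^bsup>\<alpha>\<^sub>k\<^esup>\<rangle>\<top>\<close>, bracketed to the right.\<close>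

fun mono_conj :: "(nat \<times> eps0) list \<Rightarrow> fm" where
  "mono_conj [] = Top"
| "mono_conj [(n, \<alpha>)] = dia n \<alpha> Top"
| "mono_conj ((n, \<alpha>) # p # ps) = dia n \<alpha> Top \<^bold>\<and> mono_conj (p # ps)"

text \<open>
  The leading exponent \<open>\<alpha>\<^sub>0\<close> has to be positive, here and in the Schmerl axioms: otherwise \<open>\<top>\<close>
  could be read as the monomial \<open>\<langle>n\<^sub>0\<^sup>0\<rangle>\<top>\<close> for an arbitrary \<open>n\<^sub>0\<close>, and the Schmerl axiom for it,
  \<open>\<langle>n\<^sup>\<alpha>\<rangle>\<top> \<equiv> \<langle>n\<^sup>0\<rangle>\<top> \<and> \<top>\<close>, would make all formulas equivalent.
\<close>

inductive_set MNF :: "fm set" where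
  MNF_top: "Top \<in> MNF"
| MNF_mono: "dia n \<alpha> Top \<in> MNF"
| MNF_cons: "\<lbrakk>mono_conj ((n\<^sub>0, \<alpha>\<^sub>0) # ps) \<in> MNF; 0 < \<alpha>\<^sub>0; n < n\<^sub>0; \<alpha> = hexp (n\<^sub>0 - n) \<alpha>\<^sub>0 * (2 + \<beta>)\<rbrakk>
    \<Longrightarrow> mono_conj ((n, \<alpha>) # (n\<^sub>0, \<alpha>\<^sub>0) # ps) \<in> MNF"

section \<open>The calculus \<open>TSC\<close>\<close>

inductive TSC :: "fm \<Rightarrow> fm \<Rightarrow> bool" (infix \<open>\<turnstile>\<close> 50) where
  refl: "\<phi> \<in> formulas \<Longrightarrow> \<phi> \<turnstile> \<phi>"
| top: "\<phi> \<in> formulas \<Longrightarrow> \<phi> \<turnstile> Top"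
| conj1: "\<lbrakk>\<phi> \<in> formulas; \<psi> \<in> formulas\<rbrakk> \<Longrightarrow> \<phi> \<^bold>\<and> \<psi> \<turnstile> \<phi>"
| conj2: "\<lbrakk>\<phi> \<in> formulas; \<psi> \<in> formulas\<rbrakk> \<Longrightarrow> \<phi> \<^bold>\<and> \<psi> \<turnstile> \<psi>"
| monotone: "\<lbrakk>\<phi> \<in> formulas; \<beta> \<le> \<alpha>\<rbrakk> \<Longrightarrow> dia n \<alpha> \<phi> \<turnstile> dia n \<beta> \<phi>"
| add1: "\<phi> \<in> formulas \<Longrightarrow> dia n (\<alpha> + \<beta>) \<phi> \<turnstile> dia n \<beta> (dia n \<alpha> \<phi>)"
| add2: "\<phi> \<in> formulas \<Longrightarrow> dia n \<beta> (dia n \<alpha> \<phi>) \<turnstile> dia n (\<alpha> + \<beta>) \<phi>"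
| reduce: "\<phi> \<in> formulas \<Longrightarrow> dia (m + n) \<alpha> \<phi> \<turnstile> dia m (hexp n \<alpha>) \<phi>"
| schmerl1: "\<lbrakk>mono_conj ((n\<^sub>0, \<alpha>\<^sub>0) # ps) \<in> MNF; 0 < \<alpha>\<^sub>0; n < n\<^sub>0\<rbrakk> \<Longrightarrow>
    dia n \<alpha> (mono_conj ((n\<^sub>0, \<alpha>\<^sub>0) # ps)) \<turnstile>
    mono_conj ((n, hexp (n\<^sub>0 - n) \<alpha>\<^sub>0 * (1 + \<alpha>)) # (n\<^sub>0, \<alpha>\<^sub>0) # ps)"
| schmerl2: "\<lbrakk>mono_conj ((n\<^sub>0, \<alpha>\<^sub>0) # ps) \<in> MNF; 0 < \<alpha>\<^sub>0; n < n\<^sub>0\<rbrakk> \<Longrightarrow>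
    mono_conj ((n, hexp (n\<^sub>0 - n) \<alpha>\<^sub>0 * (1 + \<alpha>)) # (n\<^sub>0, \<alpha>\<^sub>0) # ps) \<turnstile>
    dia n \<alpha> (mono_conj ((n\<^sub>0, \<alpha>\<^sub>0) # ps))"
| conjI: "\<lbrakk>\<phi> \<turnstile> \<psi>; \<phi> \<turnstile> \<chi>\<rbrakk> \<Longrightarrow> \<phi> \<turnstile> \<psi> \<^bold>\<and> \<chi>"
| cut: "\<lbrakk>\<phi> \<turnstile> \<psi>; \<psi> \<turnstile> \<chi>\<rbrakk> \<Longrightarrow> \<phi> \<turnstile> \<chi>"
| nec: "\<phi> \<turnstile> \<psi> \<Longrightarrow> dia n \<alpha> \<phi> \<turnstile> dia n \<alpha> \<psi>"
| push: "\<lbrakk>\<phi> \<turnstile> \<psi>; m < n\<rbrakk> \<Longrightarrow>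
    dia n \<alpha> \<phi> \<^bold>\<and> dia m (\<beta> + 1) \<psi> \<turnstile> dia n \<alpha> (\<phi> \<^bold>\<and> dia m (\<beta> + 1) \<psi>)"

definition TSC_equiv :: "fm \<Rightarrow> fm \<Rightarrow> bool" where
  "TSC_equiv \<phi> \<psi> \<longleftrightarrow> \<phi> \<turnstile> \<psi> \<and> \<psi> \<turnstile> \<phi>"

lemma mono_conj_in_formulas: "mono_conj ps \<in> formulas"
  by (induction ps rule: mono_conj.induct) (auto intro: formulas.intros)

lemma MNF_subset_formulas: "MNF \<subseteq> formulas"
proof
  fix \<phi> assume "\<phi> \<in> MNF"
  then show "\<phi> \<in> formulas"
    by cases (use mono_conj_in_formulas in \<open>auto intro: formulas.intros simp del: mono_conj.simps\<close>)
qed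

lemma TSC_in_formulas: "\<phi> \<turnstile> \<psi> \<Longrightarrow> \<phi> \<in> formulas \<and> \<psi> \<in> formulas"
  by (induction rule: TSC.induct)
    (auto intro: formulas.intros mono_conj_in_formulas simp del: mono_conj.simps)

lemma formulas_Mod_pos: "Mod n \<alpha> \<phi> \<in> formulas \<longleftrightarrow> 0 < \<alpha> \<and> \<phi> \<in> formulas"
proof -
  have "\<psi> = Mod n \<alpha> \<phi> \<Longrightarrow> 0 < \<alpha> \<and> \<phi> \<in> formulas" if "\<psi> \<in> formulas" for \<psi>
    using that by (induction rule: formulas.induct) (auto simp: dia_def order_less_le split: if_splits)
  moreover have "Mod n \<alpha> \<phi> \<in> formulas" if "0 < \<alpha>" "\<phi> \<in> formulas"
    using formulas.intros(3)[OF that(2), of n \<alpha>] that(1) by (auto simp: dia_def split: if_splits)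
  ultimately show ?thesis by blast
qed

end

theory Submission
  imports Defs
begin

text \<open>
  Monomial normal forms are closed, up to equivalence, under conjunction with a monomial and under
  modalities. For the conjunction of \<open>\<langle>n\<^sup>\<alpha>\<rangle>\<top>\<close> with a normal form whose first index \<open>n\<^sub>0\<close> exceeds \<open>n\<close>,
  put \<open>\<epsilon> = e\<^bsup>n\<^sub>0-n\<^esup>(\<alpha>\<^sub>0)\<close> and divide: \<open>\<alpha> = \<epsilon> \<sqdot> \<delta> + \<rho>\<close> with \<open>\<rho> < \<epsilon>\<close>. If \<open>\<rho> > 0\<close>, pushing
  \<open>\<langle>n\<^bsup>\<epsilon>\<sqdot>\<delta>+1\<^esup>\<rangle>\<top>\<close> under \<open>\<langle>n\<^sub>0\<^bsup>\<alpha>\<^sub>0\<^esup>\<rangle>\<close> and reducing \<open>n\<^sub>0\<close> to \<open>n\<close> yields \<open>\<langle>n\<^bsup>\<epsilon>\<sqdot>(\<delta>+1)\<^esup>\<rangle>\<top>\<close>, so the exponent can be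
  rounded up to a multiple of \<open>\<epsilon>\<close>. A modality \<open>\<langle>n\<^sup>\<alpha>\<rangle>\<close> with \<open>n\<close> below or equal to the first index
  is absorbed by the Schmerl axioms; a smaller index \<open>m < n\<close> is pulled out by
  \<open>\<langle>n\<^sup>\<alpha>\<rangle>(\<langle>m\<^sup>\<beta>\<rangle>\<top> \<and> \<phi>) \<equiv> \<langle>m\<^bsup>\<beta>+1\<^esup>\<rangle>\<top> \<and> \<langle>n\<^sup>\<alpha>\<rangle>\<phi>\<close>, which holds for limit \<open>\<beta>\<close> as well because reduction gains
  at least one step.
\<close>

section \<open>Ordinal arithmetic\<close>

lemma eps0_pos_iff: "0 < a \<longleftrightarrow> a \<noteq> (0::eps0)"
  by (simp add: order_less_le)

lemma eps0_one_le_iff: "1 \<le> a \<longleftrightarrow> a \<noteq> (0::eps0)"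
  by (simp flip: not_less)

lemma eps0_mult_strict_mono: "0 < a \<Longrightarrow> b < c \<Longrightarrow> a * b < a * (c::eps0)"
  using eps0_less_mult_iff[of "a * b" a c] eps0_add_less_iff[of "a * b" 0 a] by auto

text \<open>A strictly increasing map on ordinals never falls below its argument: if
  \<open>a * b < b\<close>, the induction hypothesis at \<open>a * b\<close> gives
  \<open>a * b \<le> a * (a * b)\<close>, while strict monotonicity gives
  \<open>a * (a * b) < a * b\<close>.\<close>

lemma eps0_le_mult: "0 < a \<Longrightarrow> b \<le> a * (b::eps0)"
proof (induction b rule: less_induct)
  case (less b)
  show ?case
  proof (rule ccontr)
    assume "\<not> b \<le> a * b"
    then have "a * b < b" by simp
    with less.IH[OF this less.prems] eps0_mult_strict_mono[OF less.prems this] show False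
      by simp
  qed
qed

lemma eps0_division:
  assumes "0 < (e::eps0)"
  obtains d r where "a = e * d + r" "r < e"
proof -
  have "a < e * (a + 1)"
    using eps0_le_mult[OF assms, of a] eps0_mult_strict_mono[OF assms, of a "a + 1"]
      eps0_add_less_iff[of a 0 1] by (simp add: eps0_pos_iff)
  \<comment> \<open>For the least \<open>b\<close> with \<open>a < e * b\<close>, the product
    recursion supplies \<open>d < b\<close> with \<open>a < e * d + e\<close>; minimality gives
    \<open>e * d \<le> a\<close>, so \<open>d\<close> is the quotient.\<close>
  then obtain b where b: "a < e * b" "\<And>c. c < b \<Longrightarrow> \<not> a < e * c"
    using exists_least_iff[of "\<lambda>b. a < e * b"] by blast
  then obtain d where d: "d < b" "a < e * d + e"
    using eps0_less_mult_iff by blast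
  then obtain r where "a = e * d + r"
    using b(2)[of d] eps0_le_iff_add[of "e * d" a] by auto
  then show thesis using that d by auto
qed

lemma eps0_mult_two_pos:
  assumes "0 < (e::eps0)"
  shows "0 < e * (2 + \<beta>)"
proof -
  have "(2::eps0) + \<beta> = 1 + (1 + \<beta>)"
    by (simp flip: one_add_one add: add.assoc)
  then show ?thesis
    using less_le_trans[OF assms eps0_le_add] by (simp add: eps0_mult_add)
qed

lemma hexp1_pos: "0 < a \<Longrightarrow> 0 < hexp1 a"
  by (simp add: hexp1_eq eps0_pos_iff)

lemma hexp_pos: "0 < a \<Longrightarrow> 0 < hexp k a"
  by (induction k) (simp_all add: hexp_def hexp1_pos)

section \<open>Derived rules of the calculus\<close>

notation TSC_equiv (infix \<open>\<simeq>\<close> 50)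

lemma dia_zero [simp]: "dia n 0 \<phi> = \<phi>"
  by (simp add: dia_def)

lemma dia_in_formulas [simp, intro]: "\<phi> \<in> formulas \<Longrightarrow> dia n \<alpha> \<phi> \<in> formulas"
  by (rule formulas.intros)

lemma Conj_in_formulas [simp, intro]: "\<phi> \<in> formulas \<Longrightarrow> \<psi> \<in> formulas \<Longrightarrow> \<phi> \<^bold>\<and> \<psi> \<in> formulas"
  by (rule formulas.intros)

lemma Top_in_formulas [simp, intro]: "Top \<in> formulas"
  by (rule formulas.intros)

declare mono_conj_in_formulas [simp, intro] and TSC.cut [trans]

lemma Conj_left1: "\<phi> \<turnstile> \<chi> \<Longrightarrow> \<psi> \<in> formulas \<Longrightarrow> \<phi> \<^bold>\<and> \<psi> \<turnstile> \<chi>"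
  using TSC.conj1 TSC.cut TSC_in_formulas by blast

lemma Conj_left2: "\<psi> \<turnstile> \<chi> \<Longrightarrow> \<phi> \<in> formulas \<Longrightarrow> \<phi> \<^bold>\<and> \<psi> \<turnstile> \<chi>"
  using TSC.conj2 TSC.cut TSC_in_formulas by blast

lemma Conj_mono: "\<phi> \<turnstile> \<phi>' \<Longrightarrow> \<psi> \<turnstile> \<psi>' \<Longrightarrow> \<phi> \<^bold>\<and> \<psi> \<turnstile> \<phi>' \<^bold>\<and> \<psi>'"
  by (meson TSC.conjI Conj_left1 Conj_left2 TSC_in_formulas)

lemma TSC_equiv_refl: "\<phi> \<in> formulas \<Longrightarrow> \<phi> \<simeq> \<phi>"
  by (simp add: TSC_equiv_def TSC.refl)

lemma TSC_equiv_sym: "\<phi> \<simeq> \<psi> \<Longrightarrow> \<psi> \<simeq> \<phi>"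
  by (simp add: TSC_equiv_def)

lemma TSC_equiv_trans [trans]: "\<phi> \<simeq> \<psi> \<Longrightarrow> \<psi> \<simeq> \<chi> \<Longrightarrow> \<phi> \<simeq> \<chi>"
  unfolding TSC_equiv_def by (blast intro: TSC.cut)

lemma Conj_cong: "\<phi> \<simeq> \<phi>' \<Longrightarrow> \<psi> \<simeq> \<psi>' \<Longrightarrow> \<phi> \<^bold>\<and> \<psi> \<simeq> \<phi>' \<^bold>\<and> \<psi>'"
  by (simp add: TSC_equiv_def Conj_mono)

lemma dia_cong: "\<phi> \<simeq> \<psi> \<Longrightarrow> dia n \<alpha> \<phi> \<simeq> dia n \<alpha> \<psi>"
  by (simp add: TSC_equiv_def TSC.nec)

lemma Conj_absorb: "\<psi> \<turnstile> \<phi> \<Longrightarrow> \<phi> \<^bold>\<and> \<psi> \<simeq> \<psi>"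
  by (meson TSC_equiv_def TSC.conj2 TSC.conjI TSC.refl TSC_in_formulas)

lemma Conj_assoc:
  assumes "\<phi> \<in> formulas" "\<psi> \<in> formulas" "\<chi> \<in> formulas"
  shows "(\<phi> \<^bold>\<and> \<psi>) \<^bold>\<and> \<chi> \<simeq> \<phi> \<^bold>\<and> \<psi> \<^bold>\<and> \<chi>"
  unfolding TSC_equiv_def using assms
  by (intro HOL.conjI TSC.conjI)
    (auto intro: Conj_left1 Conj_left2 TSC.refl)

lemma Conj_left_commute:
  assumes "\<phi> \<in> formulas" "\<psi> \<in> formulas" "\<chi> \<in> formulas"
  shows "\<phi> \<^bold>\<and> \<psi> \<^bold>\<and> \<chi> \<simeq> \<psi> \<^bold>\<and> \<phi> \<^bold>\<and> \<chi>"
  unfolding TSC_equiv_def using assms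
  by (intro HOL.conjI TSC.conjI)
    (auto intro: Conj_left1 Conj_left2 TSC.refl)

lemma dia_add: "\<phi> \<in> formulas \<Longrightarrow> dia n \<beta> (dia n \<alpha> \<phi>) \<simeq> dia n (\<alpha> + \<beta>) \<phi>"
  by (simp add: TSC_equiv_def TSC.add1 TSC.add2)

lemma dia_reduce:
  assumes "\<phi> \<in> formulas" "m \<le> n"
  shows "dia n \<alpha> \<phi> \<turnstile> dia m (hexp (n - m) \<alpha>) \<phi>"
  using TSC.reduce[OF assms(1), of m "n - m" \<alpha>] assms(2) by simp

lemma dia_dia_reduce:
  assumes "\<phi> \<in> formulas" "m \<le> n"
  shows "dia n \<alpha> (dia m \<beta> \<phi>) \<turnstile> dia m (\<beta> + hexp (n - m) \<alpha>) \<phi>"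
  by (rule TSC.cut[OF dia_reduce TSC.add2]) (use assms in auto)

text \<open>From left to right, reducing \<open>n\<close> to \<open>m\<close> adds
  \<open>hexp (n - m) \<alpha>\<close>, which is at least 1, to \<open>\<beta>\<close>. From right
  to left, \<open>push\<close> requires a successor exponent, and \<open>\<beta> + 1\<close> is
  one.\<close>

lemma dia_Conj_pull_out:
  assumes "\<phi> \<in> formulas" "0 < \<alpha>" "m < n"
  shows "dia n \<alpha> (dia m \<beta> Top \<^bold>\<and> \<phi>) \<simeq> dia m (\<beta> + 1) Top \<^bold>\<and> dia n \<alpha> \<phi>"
  unfolding TSC_equiv_def
proof (intro HOL.conjI TSC.conjI)
  have "dia n \<alpha> (dia m \<beta> Top \<^bold>\<and> \<phi>) \<turnstile> dia n \<alpha> (dia m \<beta> Top)"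
    using assms by (auto intro: TSC.nec TSC.conj1)
  also have "\<dots> \<turnstile> dia m (\<beta> + hexp (n - m) \<alpha>) Top"
    using assms by (intro dia_dia_reduce) auto
  also have "\<dots> \<turnstile> dia m (\<beta> + 1) Top"
    using hexp_pos[OF assms(2), of "n - m"]
    by (intro TSC.monotone) (auto simp: eps0_one_le_iff)
  finally show "dia n \<alpha> (dia m \<beta> Top \<^bold>\<and> \<phi>) \<turnstile> dia m (\<beta> + 1) Top" .
  show "dia n \<alpha> (dia m \<beta> Top \<^bold>\<and> \<phi>) \<turnstile> dia n \<alpha> \<phi>"
    using assms by (auto intro: TSC.nec TSC.conj2)
  have "dia m (\<beta> + 1) Top \<^bold>\<and> dia n \<alpha> \<phi> \<turnstile> dia n \<alpha> \<phi> \<^bold>\<and> dia m (\<beta> + 1) Top"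
    using assms by (auto intro: TSC.conjI TSC.conj1 TSC.conj2)
  also have "\<dots> \<turnstile> dia n \<alpha> (\<phi> \<^bold>\<and> dia m (\<beta> + 1) Top)"
    using assms by (intro TSC.push TSC.top)
  also have "\<dots> \<turnstile> dia n \<alpha> (dia m \<beta> Top \<^bold>\<and> \<phi>)"
    using assms
    by (intro TSC.nec TSC.conjI Conj_left2 TSC.monotone TSC.conj1) auto
  finally show "dia m (\<beta> + 1) Top \<^bold>\<and> dia n \<alpha> \<phi> \<turnstile> dia n \<alpha> (dia m \<beta> Top \<^bold>\<and> \<phi>)" .
qed

section \<open>Normal forms as lists\<close>

text \<open>Lists allow induction on the leading monomial. Exponent 0 is excluded, so that
  \<open>[]\<close> is the only such list for \<open>Top\<close>; for all but the last entry,
  positivity follows from the shape of the exponent.\<close>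

fun mnf :: "(nat \<times> eps0) list \<Rightarrow> bool" where
  "mnf [] = True"
| "mnf [(n, \<alpha>)] = (0 < \<alpha>)"
| "mnf ((n, \<alpha>) # (n\<^sub>0, \<alpha>\<^sub>0) # ps) =
     (mnf ((n\<^sub>0, \<alpha>\<^sub>0) # ps) \<and> n < n\<^sub>0 \<and> (\<exists>\<beta>. \<alpha> = hexp (n\<^sub>0 - n) \<alpha>\<^sub>0 * (2 + \<beta>)))"

lemma mnf_head_pos: "mnf ((n, \<alpha>) # ps) \<Longrightarrow> 0 < \<alpha>"
proof (induction "(n, \<alpha>) # ps" arbitrary: n \<alpha> ps rule: mnf.induct)
  case (3 n \<alpha> n\<^sub>0 \<alpha>\<^sub>0 ps)
  then show ?case by (auto intro: eps0_mult_two_pos hexp_pos)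
qed simp

lemma mnf_tail: "mnf (p # ps) \<Longrightarrow> mnf ps"
  by (cases "p # ps" rule: mnf.cases) auto

lemma mnf_in_MNF: "mnf ps \<Longrightarrow> mono_conj ps \<in> MNF"
proof (induction ps rule: mnf.induct)
  case (3 n \<alpha> n\<^sub>0 \<alpha>\<^sub>0 ps)
  then show ?case
    by (auto intro: MNF_cons mnf_head_pos simp del: mono_conj.simps)
qed (auto intro: MNF.intros)

text \<open>This is only an equivalence because \<open>mono_conj\<close> of a one-element list has
  no trailing \<open>Top\<close>.\<close>

lemma mono_conj_Cons: "mono_conj ((n, \<alpha>) # ps) \<simeq> dia n \<alpha> Top \<^bold>\<and> mono_conj ps"
proof (cases ps)
  case Nil
  then show ?thesis
    unfolding TSC_equiv_def by (auto intro: TSC.conjI TSC.conj1 TSC.refl TSC.top)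
next
  case (Cons p qs)
  then show ?thesis by (auto intro!: TSC_equiv_refl)
qed

lemma mono_conj_head: "mono_conj ((n, \<alpha>) # ps) \<turnstile> dia n \<alpha> Top"
  using mono_conj_Cons[of n \<alpha> ps] unfolding TSC_equiv_def
  by (auto intro: TSC.cut[OF _ TSC.conj1])

lemma schmerl:
  assumes "mnf ((n\<^sub>0, \<alpha>\<^sub>0) # ps)" "n < n\<^sub>0"
  shows "dia n \<alpha> (mono_conj ((n\<^sub>0, \<alpha>\<^sub>0) # ps)) \<simeq>
    mono_conj ((n, hexp (n\<^sub>0 - n) \<alpha>\<^sub>0 * (1 + \<alpha>)) # (n\<^sub>0, \<alpha>\<^sub>0) # ps)"
  unfolding TSC_equiv_def
  using TSC.schmerl1 TSC.schmerl2 mnf_in_MNF mnf_head_pos assms by blast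

section \<open>Closure under conjunction\<close>

lemma round_up_exponent:
  assumes "n < n\<^sub>0" "0 < \<rho>"
  shows "dia n (\<gamma> + \<rho>) Top \<^bold>\<and> dia n\<^sub>0 \<alpha>\<^sub>0 Top \<turnstile> dia n (\<gamma> + hexp (n\<^sub>0 - n) \<alpha>\<^sub>0) Top"
proof -
  \<comment> \<open>The remainder is first weakened to 1, since \<open>push\<close> needs a
    successor exponent.\<close>
  have "dia n (\<gamma> + \<rho>) Top \<^bold>\<and> dia n\<^sub>0 \<alpha>\<^sub>0 Top \<turnstile> dia n (\<gamma> + 1) Top \<^bold>\<and> dia n\<^sub>0 \<alpha>\<^sub>0 Top"
    using assms(2) by (intro Conj_mono TSC.monotone TSC.refl) (auto simp: eps0_one_le_iff)
  also have "\<dots> \<turnstile> dia n\<^sub>0 \<alpha>\<^sub>0 Top \<^bold>\<and> dia n (\<gamma> + 1) Top"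
    by (auto intro: TSC.conjI TSC.conj1 TSC.conj2)
  also have "\<dots> \<turnstile> dia n\<^sub>0 \<alpha>\<^sub>0 (Top \<^bold>\<and> dia n (\<gamma> + 1) Top)"
    using assms by (intro TSC.push TSC.top) auto
  also have "\<dots> \<turnstile> dia n\<^sub>0 \<alpha>\<^sub>0 (dia n (\<gamma> + 1) Top)"
    by (auto intro: TSC.nec TSC.conj2)
  also have "\<dots> \<turnstile> dia n (\<gamma> + 1 + hexp (n\<^sub>0 - n) \<alpha>\<^sub>0) Top"
    using assms by (intro dia_dia_reduce) auto
  \<comment> \<open>The extra 1 sits to the left of the \<open>hexp\<close> term, so dropping it
    cannot increase the exponent.\<close>
  also have "\<dots> \<turnstile> dia n (\<gamma> + hexp (n\<^sub>0 - n) \<alpha>\<^sub>0) Top"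
    by (intro TSC.monotone) (auto simp: add.assoc eps0_le_add_left)
  finally show ?thesis .
qed

lemma monomial_below_conj:
  assumes "mnf ps" "0 < \<alpha>" "ps \<noteq> [] \<Longrightarrow> n < fst (hd ps)"
  shows "\<exists>qs. mnf qs \<and> qs \<noteq> [] \<and> fst (hd qs) \<ge> n \<and> dia n \<alpha> Top \<^bold>\<and> mono_conj ps \<simeq> mono_conj qs"
proof (cases ps)
  case Nil
  then show ?thesis
    using assms(2) mono_conj_Cons[of n \<alpha> "[]"]
    by (intro exI[of _ "[(n, \<alpha>)]"]) (auto intro: TSC_equiv_sym)
next
  case (Cons p rs)
  obtain n\<^sub>0 \<alpha>\<^sub>0 where p: "p = (n\<^sub>0, \<alpha>\<^sub>0)" by (cases p)
  with Cons assms have less: "n < n\<^sub>0" and pos: "0 < \<alpha>\<^sub>0" by (auto dest: mnf_head_pos)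
  define e where "e = hexp (n\<^sub>0 - n) \<alpha>\<^sub>0"
  have "0 < e" using pos by (simp add: e_def hexp_pos)
  have head: "mono_conj ps \<turnstile> dia n\<^sub>0 \<alpha>\<^sub>0 Top" using Cons p mono_conj_head by simp
  show ?thesis
  proof (cases "\<alpha> \<le> e")
    case True
    \<comment> \<open>Reducing the leading monomial to index \<open>n\<close> already yields
      exponent \<open>e\<close>, so the new monomial is redundant.\<close>
    have "mono_conj ps \<turnstile> dia n e Top"
      using TSC.cut[OF head dia_reduce] less by (simp add: e_def)
    also have "\<dots> \<turnstile> dia n \<alpha> Top" using True by (intro TSC.monotone) auto
    finally show ?thesis
      using assms(1) Cons p less by (intro exI[of _ ps]) (auto intro: Conj_absorb)
  next
    case False
    obtain \<delta> \<rho> where div: "\<alpha> = e * \<delta> + \<rho>" "\<rho> < e" using eps0_division[OF \<open>0 < e\<close>] by blast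
    have "\<exists>\<beta>. dia n \<alpha> Top \<^bold>\<and> mono_conj ps \<simeq> dia n (e * (2 + \<beta>)) Top \<^bold>\<and> mono_conj ps"
    proof (cases "\<rho> = 0")
      case True
      \<comment> \<open>Here \<alpha> is already a multiple of \<open>e\<close>; a factor of at most
        1 would contradict \<open>\<alpha> > e\<close>.\<close>
      have "\<not> \<delta> < 2"
      proof
        assume "\<delta> < 2"
        then have "\<delta> \<le> 1"
          by (auto simp flip: one_add_one simp: eps0_less_add_iff)
        then have "e * \<delta> \<le> e"
          using eps0_mult_strict_mono[OF \<open>0 < e\<close>, of \<delta> 1] by (auto simp: order_le_less)
        then show False using False True div by simp
      qed
      then obtain \<beta> where "\<delta> = 2 + \<beta>" using eps0_le_iff_add[of 2 \<delta>] by auto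
      then show ?thesis using True div by (intro exI[of _ \<beta>]) (auto intro: TSC_equiv_refl)
    next
      case nz: False
      \<comment> \<open>With quotient 0, \<alpha> would be the remainder and lie below
        \<open>e\<close>. Hence the rounded-up factor \<open>\<delta> + 1\<close> is at least
        2.\<close>
      have "\<delta> \<noteq> 0" using False div by auto
      then have "2 \<le> \<delta> + 1"
        using eps0_add_left_mono[of 1 \<delta> 1] by (simp add: eps0_one_le_iff)
      then obtain \<beta> where \<beta>: "\<delta> + 1 = 2 + \<beta>" using eps0_le_iff_add[of 2 "\<delta> + 1"] by auto
      then have e\<beta>: "e * (2 + \<beta>) = e * \<delta> + e" by (simp flip: \<beta> add: eps0_mult_add)
      have "dia n \<alpha> Top \<^bold>\<and> mono_conj ps \<turnstile> dia n (e * \<delta> + e) Top"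
      proof (rule TSC.cut)
        show "dia n \<alpha> Top \<^bold>\<and> mono_conj ps \<turnstile> dia n (e * \<delta> + \<rho>) Top \<^bold>\<and> dia n\<^sub>0 \<alpha>\<^sub>0 Top"
          using head div by (auto intro: Conj_mono TSC.refl)
      qed (use round_up_exponent[OF less, of \<rho> "e * \<delta>"] nz in \<open>simp add: e_def eps0_pos_iff\<close>)
      moreover have "dia n (e * \<delta> + e) Top \<turnstile> dia n \<alpha> Top"
        using div by (intro TSC.monotone) auto
      ultimately have "dia n \<alpha> Top \<^bold>\<and> mono_conj ps \<simeq> dia n (e * \<delta> + e) Top \<^bold>\<and> mono_conj ps"
        unfolding TSC_equiv_def by (auto intro: Conj_mono TSC.refl TSC.conj2 TSC.conjI)
      then show ?thesis using e\<beta> by metis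
    qed
    then obtain \<beta> where "dia n \<alpha> Top \<^bold>\<and> mono_conj ps \<simeq> dia n (e * (2 + \<beta>)) Top \<^bold>\<and> mono_conj ps" ..
    also have "\<dots> \<simeq> mono_conj ((n, e * (2 + \<beta>)) # ps)"
      by (rule TSC_equiv_sym[OF mono_conj_Cons])
    finally show ?thesis
      using assms(1) Cons p less
      by (intro exI[of _ "(n, e * (2 + \<beta>)) # ps"]) (auto simp: e_def)
  qed
qed

text \<open>The bound on the first index of \<open>qs\<close> strengthens the induction: a smaller
  index \<open>k\<close> split off from the front of the list stays below the merged tail, so its
  monomial can be put back.\<close>

lemma monomial_conj:
  assumes "mnf ps" "0 < \<alpha>"
  shows "\<exists>qs. mnf qs \<and> qs \<noteq> [] \<and> (\<forall>m<n. (ps \<noteq> [] \<longrightarrow> m < fst (hd ps)) \<longrightarrow> m < fst (hd qs)) \<and>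
    dia n \<alpha> Top \<^bold>\<and> mono_conj ps \<simeq> mono_conj qs"
  using assms(1)
proof (induction ps)
  case Nil
  then show ?case using monomial_below_conj[of "[]" \<alpha> n] assms(2) by fastforce
next
  case (Cons p ps)
  obtain k \<gamma> where p: "p = (k, \<gamma>)" by (cases p)
  have tail: "mnf ps" using Cons.prems by (rule mnf_tail)
  have \<gamma>: "0 < \<gamma>" using Cons.prems p mnf_head_pos by simp
  have k: "k < fst (hd ps)" if "ps \<noteq> []"
    using Cons.prems p that by (cases ps) auto
  have mem: "dia n \<alpha> Top \<in> formulas" "dia k \<gamma> Top \<in> formulas" "mono_conj ps \<in> formulas"
    by simp_all
  have unfold: "dia n \<alpha> Top \<^bold>\<and> mono_conj (p # ps) \<simeq> dia n \<alpha> Top \<^bold>\<and> dia k \<gamma> Top \<^bold>\<and> mono_conj ps"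
    using mono_conj_Cons p by (auto intro: Conj_cong TSC_equiv_refl)
  consider "n < k" | "n = k" "\<alpha> \<le> \<gamma>" | "n = k" "\<gamma> < \<alpha>" | "k < n" by force
  then show ?case
  proof cases
    case 1
    then show ?thesis
      using monomial_below_conj[OF Cons.prems assms(2), of n] p by fastforce
  next
    case 2
    have "mono_conj (p # ps) \<turnstile> dia k \<gamma> Top" using mono_conj_head p by simp
    also have "\<dots> \<turnstile> dia n \<alpha> Top" using 2 by (auto intro: TSC.monotone)
    finally have "dia n \<alpha> Top \<^bold>\<and> mono_conj (p # ps) \<simeq> mono_conj (p # ps)"
      by (rule Conj_absorb)
    then show ?thesis using Cons.prems by (intro exI[of _ "p # ps"]) auto
  next
    case 3
    have "dia n \<alpha> Top \<^bold>\<and> mono_conj (p # ps) \<simeq> dia k \<gamma> Top \<^bold>\<and> dia n \<alpha> Top \<^bold>\<and> mono_conj ps"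
      by (rule TSC_equiv_trans[OF unfold Conj_left_commute[OF mem]])
    \<comment> \<open>The old leading monomial follows from the new one of equal index and larger
      exponent.\<close>
    also have "\<dots> \<simeq> dia n \<alpha> Top \<^bold>\<and> mono_conj ps"
      using 3 by (auto intro!: Conj_absorb Conj_left1 TSC.monotone)
    finally show ?thesis
      using monomial_below_conj[OF tail assms(2), of n] k 3 p
      by (fastforce intro: TSC_equiv_trans)
  next
    case 4
    \<comment> \<open>The new monomial is merged into the tail first. The old leading monomial is
      then normalized again, because the head of the tail, and with it the admissible multiples, may
      have changed.\<close>
    obtain qs where qs: "mnf qs" "qs \<noteq> []"
      "\<And>m. m < n \<Longrightarrow> (ps \<noteq> [] \<longrightarrow> m < fst (hd ps)) \<Longrightarrow> m < fst (hd qs)"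
      "dia n \<alpha> Top \<^bold>\<and> mono_conj ps \<simeq> mono_conj qs"
      using Cons.IH[OF tail] by blast
    have "dia n \<alpha> Top \<^bold>\<and> mono_conj (p # ps) \<simeq> dia k \<gamma> Top \<^bold>\<and> dia n \<alpha> Top \<^bold>\<and> mono_conj ps"
      by (rule TSC_equiv_trans[OF unfold Conj_left_commute[OF mem]])
    also have "\<dots> \<simeq> dia k \<gamma> Top \<^bold>\<and> mono_conj qs"
      using qs(4) by (intro Conj_cong TSC_equiv_refl) auto
    finally have eq: "dia n \<alpha> Top \<^bold>\<and> mono_conj (p # ps) \<simeq> dia k \<gamma> Top \<^bold>\<and> mono_conj qs" .
    have "k < fst (hd qs)" using qs(3)[OF 4] k by simp
    then obtain rs where "mnf rs" "rs \<noteq> []" "k \<le> fst (hd rs)"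
      "dia k \<gamma> Top \<^bold>\<and> mono_conj qs \<simeq> mono_conj rs"
      using monomial_below_conj[OF qs(1) \<gamma>] by blast
    then show ?thesis
      using eq p by (intro exI[of _ rs]) (auto intro: TSC_equiv_trans)
  qed
qed

lemma mnf_conj:
  assumes "mnf ps" "mnf qs"
  shows "\<exists>rs. mnf rs \<and> mono_conj ps \<^bold>\<and> mono_conj qs \<simeq> mono_conj rs"
  using assms(1)
proof (induction ps)
  case Nil
  have "mono_conj [] \<^bold>\<and> mono_conj qs \<simeq> mono_conj qs"
    by (auto intro!: Conj_absorb TSC.top)
  then show ?case using assms(2) by blast
next
  case (Cons p ps)
  obtain n \<alpha> where p: "p = (n, \<alpha>)" by (cases p)
  have \<alpha>: "0 < \<alpha>" using Cons.prems p mnf_head_pos by simp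
  obtain rs where rs: "mnf rs" "mono_conj ps \<^bold>\<and> mono_conj qs \<simeq> mono_conj rs"
    using Cons mnf_tail by blast
  have "mono_conj (p # ps) \<^bold>\<and> mono_conj qs \<simeq> (dia n \<alpha> Top \<^bold>\<and> mono_conj ps) \<^bold>\<and> mono_conj qs"
    using p by (auto intro!: Conj_cong mono_conj_Cons TSC_equiv_refl)
  also have "\<dots> \<simeq> dia n \<alpha> Top \<^bold>\<and> mono_conj ps \<^bold>\<and> mono_conj qs"
    by (rule Conj_assoc) auto
  also have "\<dots> \<simeq> dia n \<alpha> Top \<^bold>\<and> mono_conj rs"
    by (auto intro: Conj_cong TSC_equiv_refl rs)
  finally show ?case
    using monomial_conj[OF rs(1) \<alpha>, of n] TSC_equiv_trans by blast
qed

section \<open>Closure under modalities\<close>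

lemma mnf_dia_below:
  assumes "mnf ps" "0 < \<alpha>" "ps \<noteq> [] \<Longrightarrow> n < fst (hd ps)"
  shows "\<exists>qs. mnf qs \<and> dia n \<alpha> (mono_conj ps) \<simeq> mono_conj qs"
proof (cases ps)
  case Nil
  then show ?thesis
    using assms(2) by (intro exI[of _ "[(n, \<alpha>)]"]) (auto intro: TSC_equiv_refl)
next
  case (Cons p rs)
  obtain n\<^sub>0 \<alpha>\<^sub>0 where p: "p = (n\<^sub>0, \<alpha>\<^sub>0)" by (cases p)
  \<comment> \<open>The Schmerl factor \<open>1 + \<alpha>\<close> thereby takes the form
    \<open>2 + \<beta>\<close> that \<open>mnf\<close> demands.\<close>
  obtain \<beta> where "\<alpha> = 1 + \<beta>"
    using assms(2) eps0_le_iff_add[of 1 \<alpha>] by (auto simp: eps0_one_le_iff eps0_pos_iff)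
  then have "1 + \<alpha> = 2 + \<beta>" by (simp flip: one_add_one add: add.assoc)
  then show ?thesis
    using schmerl[of n\<^sub>0 \<alpha>\<^sub>0 rs n \<alpha>] assms Cons p
    by (intro exI[of _ "(n, hexp (n\<^sub>0 - n) \<alpha>\<^sub>0 * (1 + \<alpha>)) # ps"]) auto
qed

text \<open>Reading the Schmerl equivalence backwards turns the leading monomial into a modality,
  which can then be merged with another modality of the same index.\<close>

lemma mnf_eq_dia:
  assumes "mnf ((n, \<alpha>) # ps)"
  obtains \<gamma> where "0 < \<gamma>" "mono_conj ((n, \<alpha>) # ps) \<simeq> dia n \<gamma> (mono_conj ps)"
proof (cases ps)
  case Nil
  then show thesis using that[of \<alpha>] assms by (auto intro: TSC_equiv_refl)
next
  case (Cons p qs)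
  obtain n\<^sub>0 \<alpha>\<^sub>0 where p: "p = (n\<^sub>0, \<alpha>\<^sub>0)" by (cases p)
  then obtain \<beta> where "\<alpha> = hexp (n\<^sub>0 - n) \<alpha>\<^sub>0 * (2 + \<beta>)" using assms Cons by auto
  moreover have "1 + (1 + \<beta>) = 2 + \<beta>" by (simp flip: one_add_one add: add.assoc)
  ultimately have "mono_conj ((n, \<alpha>) # ps) \<simeq> dia n (1 + \<beta>) (mono_conj ps)"
    using schmerl[of n\<^sub>0 \<alpha>\<^sub>0 qs n "1 + \<beta>"] assms Cons p by (auto intro: TSC_equiv_sym)
  moreover have "0 < 1 + \<beta>"
    using less_le_trans[OF _ eps0_le_add, of 0 1 \<beta>] by (simp add: eps0_pos_iff flip: eps0_one_le_iff)
  ultimately show thesis using that by blast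
qed

lemma mnf_dia:
  assumes "mnf ps" "0 < \<alpha>"
  shows "\<exists>qs. mnf qs \<and> dia n \<alpha> (mono_conj ps) \<simeq> mono_conj qs"
  using assms(1)
proof (induction ps)
  case Nil
  then show ?case using mnf_dia_below[of "[]"] assms(2) by simp
next
  case (Cons p ps)
  obtain k \<beta> where p: "p = (k, \<beta>)" by (cases p)
  have tail: "mnf ps" using Cons.prems by (rule mnf_tail)
  consider "n < k" | "n = k" | "k < n" by force
  then show ?case
  proof cases
    case 1
    then show ?thesis using mnf_dia_below[OF Cons.prems assms(2)] p by simp
  next
    case 2
    \<comment> \<open>Both modalities of index \<open>n\<close> combine to exponent
      \<open>\<gamma> + \<alpha>\<close> over the tail, whose indices start above
      \<open>n\<close>.\<close>
    obtain \<gamma> where \<gamma>: "0 < \<gamma>" "mono_conj (p # ps) \<simeq> dia n \<gamma> (mono_conj ps)"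
      using mnf_eq_dia Cons.prems p 2 by blast
    then have "dia n \<alpha> (mono_conj (p # ps)) \<simeq> dia n \<alpha> (dia n \<gamma> (mono_conj ps))"
      by (intro dia_cong)
    also have "\<dots> \<simeq> dia n (\<gamma> + \<alpha>) (mono_conj ps)" by (rule dia_add) simp
    finally have eq: "dia n \<alpha> (mono_conj (p # ps)) \<simeq> dia n (\<gamma> + \<alpha>) (mono_conj ps)" .
    have "0 < \<gamma> + \<alpha>" using less_le_trans[OF \<gamma>(1) eps0_le_add] .
    moreover have "n < fst (hd ps)" if "ps \<noteq> []"
      using Cons.prems p 2 that by (cases ps) auto
    ultimately show ?thesis
      using mnf_dia_below[OF tail] eq TSC_equiv_trans by blast
  next
    case 3
    obtain qs where qs: "mnf qs" "dia n \<alpha> (mono_conj ps) \<simeq> mono_conj qs"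
      using Cons.IH[OF tail] by blast
    have "dia n \<alpha> (mono_conj (p # ps)) \<simeq> dia n \<alpha> (dia k \<beta> Top \<^bold>\<and> mono_conj ps)"
      using p by (auto intro: dia_cong mono_conj_Cons)
    also have "\<dots> \<simeq> dia k (\<beta> + 1) Top \<^bold>\<and> dia n \<alpha> (mono_conj ps)"
      using assms(2) 3 by (intro dia_Conj_pull_out) auto
    also have "\<dots> \<simeq> dia k (\<beta> + 1) Top \<^bold>\<and> mono_conj qs"
      using qs by (intro Conj_cong TSC_equiv_refl) auto
    finally have eq: "dia n \<alpha> (mono_conj (p # ps)) \<simeq> dia k (\<beta> + 1) Top \<^bold>\<and> mono_conj qs" .
    have "0 < \<beta>" using Cons.prems p mnf_head_pos by simp
    then have "0 < \<beta> + 1" by (rule less_le_trans) simp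
    \<comment> \<open>The raised exponent \<open>\<beta> + 1\<close> need not have the form required
      over \<open>qs\<close>; \<open>monomial_conj\<close> restores a normal form.\<close>
    then show ?thesis
      using monomial_conj[OF qs(1)] eq TSC_equiv_trans by blast
  qed
qed

lemma formula_equiv_mnf:
  assumes "\<phi> \<in> formulas"
  shows "\<exists>ps. mnf ps \<and> \<phi> \<simeq> mono_conj ps"
  using assms
proof (induction rule: formulas.induct)
  case 1
  show ?case by (intro exI[of _ "[]"]) (simp add: TSC_equiv_refl)
next
  case (2 \<phi> \<psi>)
  then obtain ps qs where "mnf ps" "\<phi> \<simeq> mono_conj ps" "mnf qs" "\<psi> \<simeq> mono_conj qs" by blast
  then show ?case using mnf_conj Conj_cong TSC_equiv_trans by meson
next
  case (3 \<phi> n \<alpha>)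
  then obtain ps where ps: "mnf ps" "\<phi> \<simeq> mono_conj ps" by blast
  show ?case
  proof (cases "\<alpha> = 0")
    case True
    then show ?thesis using ps by auto
  next
    case False
    then show ?thesis
      using ps mnf_dia[of ps \<alpha> n] dia_cong TSC_equiv_trans by (meson eps0_pos_iff)
  qed
qed

theorem theorem5p10:
  fixes \<phi> :: fm
  assumes "\<phi> \<in> formulas"
  shows "\<exists>\<psi>\<in>MNF. TSC_equiv \<phi> \<psi>"
  using formula_equiv_mnf[OF assms] mnf_in_MNF by blast

end
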